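(* Let $c$ be a fixed constant. There is a polynomial-time algorithm that, given a ranked reseeding cup competition on a set of teams $V$ with tournament graph $G=(V,E)$, a coalition $C\subseteq V$ with $|C|\le c$, and a team $v_w\in V$, determines a set of manipulations by $C$ that makes $v_w$ win the cup, or determines that none exists.
   Context: A tournament is a directed graph $G=(V,E)$ whose underlying undirected graph is complete, with exactly one directed edge between any two distinct teams; $(v_i,v_j)\in E$ means that $v_i$ beats $v_j$ in a fair game. A manipulation replaces an edge $(v_i,v_j)$ by $(v_j,v_i)$; it is allowed only if $v_i\in C$, i.e. coalition members may only throw games they would have won. A ranked reseeding cup is a single-elimination competition with a given ranking (linear order) of the teams. In every round the remaining teams are paired anew according to the ranking: the best-ranked remaining team plays the worst-ranked remaining team, the second best plays the second worst, and so on. The losers are eliminated and the winners proceed to the next round, until one team, the winner of the cup, remains. If the number $m$ of teams is not a power of two, top-ranked teams receive byes (skip a game) in the first round so that the number of teams in the next round is a power of two. Games are decided by the (manipulated) tournament graph. *)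

theory Defs
  imports "HOL-Computational_Algebra.Polynomial"
begin

section \<open>Tournaments, manipulations, and ranked reseeding cups\<close>

definition tournament :: "'a set \<Rightarrow> 'a rel \<Rightarrow> bool" where
  "tournament V E \<longleftrightarrow>
     finite V \<and> E \<subseteq> V \<times> V \<and> irrefl E \<and>
     (\<forall>u\<in>V. \<forall>v\<in>V. u \<noteq> v \<longrightarrow> ((u, v) \<in> E \<longleftrightarrow> (v, u) \<notin> E))"

definition manipulations_by :: "'a set \<Rightarrow> 'a rel \<Rightarrow> 'a rel \<Rightarrow> bool" where
  "manipulations_by C E M \<longleftrightarrow> M \<subseteq> E \<and> (\<forall>(u, v)\<in>M. u \<in> C)"

definition manipulate :: "'a rel \<Rightarrow> 'a rel \<Rightarrow> 'a rel" where
  "manipulate E M = (E - M) \<union> M\<inverse>"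

text \<open>
  A ranking is a list without repetitions, best team first; the remaining teams are always
  listed in this order. Let \<open>2 ^ k\<close> be the least power of two that is at least \<open>n\<close>.
  With \<open>byes n = 2 ^ k - n\<close> byes among \<open>n\<close> teams, \<open>byes n + (n - byes n) / 2 = 2 ^ (k - 1)\<close>
  teams proceed if \<open>n > 1\<close>. In particular there are no byes if \<open>n\<close> is a power of two, hence
  none after the first round.
\<close>

definition byes :: "nat \<Rightarrow> nat" where
  "byes n = (LEAST b. \<exists>k. n + b = 2 ^ k)"

text \<open>
  In \<open>zip ts (rev ts)\<close> every team of \<open>ts\<close> stands next to its opponent, so every game occurs
  there twice, once in each direction, and exactly the winner's entry is in \<open>E\<close>.
\<close>

definition game_winners :: "'a rel \<Rightarrow> 'a list \<Rightarrow> 'a list" where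
  "game_winners E ts = map fst (filter (\<lambda>g. g \<in> E) (zip ts (rev ts)))"

definition next_round :: "'a rel \<Rightarrow> 'a list \<Rightarrow> 'a list" where
  "next_round E ts =
     (let b = byes (length ts) in take b ts @ game_winners E (drop b ts))"

inductive wins_cup :: "'a rel \<Rightarrow> 'a list \<Rightarrow> 'a \<Rightarrow> bool" for E :: "'a rel" where
  last_team: "wins_cup E [v] v"
| round: "\<lbrakk>length ts > 1; wins_cup E (next_round E ts) v\<rbrakk> \<Longrightarrow> wins_cup E ts v"

lemma wins_cup_unique: "wins_cup E ts v \<Longrightarrow> wins_cup E ts w \<Longrightarrow> v = w"
proof (induction arbitrary: w rule: wins_cup.induct)
  case (last_team v)
  then show ?case by cases auto
next
  case (round ts v)
  from round.prems show ?case
  proof cases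
    case last_team
    with round.hyps show ?thesis by simp
  next
    case round
    with \<open>\<And>w. wins_cup E (next_round E ts) w \<Longrightarrow> v = w\<close> show ?thesis by blast
  qed
qed


section \<open>Polynomial-time computation\<close>

text \<open>
  The model of computation is Neil Jones's language WHILE on binary trees, except for the cost
  measure: every evaluation of a subexpression costs the number of nodes of its value, instead
  of a constant. Reading or copying a variable and testing two trees for equality are thus
  charged in full, and since running time also bounds the growth of the store, polynomial time
  in this model coincides with polynomial time on Turing machines.
\<close>

datatype bt = Lf | Br bt bt

fun nodes :: "bt \<Rightarrow> nat" where
  "nodes Lf = 1"
| "nodes (Br a b) = 1 + nodes a + nodes b"

datatype expr = Var nat | Nil_E | Cons_E expr expr | Hd_E expr | Tl_E expr | Eq_E expr expr

type_synonym store = "nat \<Rightarrow> bt"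

fun hd_bt :: "bt \<Rightarrow> bt" where
  "hd_bt Lf = Lf"
| "hd_bt (Br a b) = a"

fun tl_bt :: "bt \<Rightarrow> bt" where
  "tl_bt Lf = Lf"
| "tl_bt (Br a b) = b"

fun val :: "expr \<Rightarrow> store \<Rightarrow> bt" where
  "val (Var x) s = s x"
| "val Nil_E s = Lf"
| "val (Cons_E e f) s = Br (val e s) (val f s)"
| "val (Hd_E e) s = hd_bt (val e s)"
| "val (Tl_E e) s = tl_bt (val e s)"
| "val (Eq_E e f) s = (if val e s = val f s then Br Lf Lf else Lf)"

fun cost :: "expr \<Rightarrow> store \<Rightarrow> nat" where
  "cost (Var x) s = nodes (val (Var x) s)"
| "cost Nil_E s = nodes (val Nil_E s)"
| "cost (Cons_E e f) s = nodes (val (Cons_E e f) s) + cost e s + cost f s"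
| "cost (Hd_E e) s = nodes (val (Hd_E e) s) + cost e s"
| "cost (Tl_E e) s = nodes (val (Tl_E e) s) + cost e s"
| "cost (Eq_E e f) s = nodes (val (Eq_E e f) s) + cost e s + cost f s"

datatype com = Skip | Assign nat expr | Seq com com | If expr com com | While expr com

text \<open>
  \<open>exec p s t s'\<close>: started in store \<open>s\<close>, the program \<open>p\<close> halts in store \<open>s'\<close> after time \<open>t\<close>.
  As a condition, \<open>Lf\<close> is false and every other tree is true.
\<close>

inductive exec :: "com \<Rightarrow> store \<Rightarrow> nat \<Rightarrow> store \<Rightarrow> bool" where
  exec_Skip: "exec Skip s 1 s"
| exec_Assign: "exec (Assign x e) s (1 + cost e s) (s(x := val e s))"
| exec_Seq: "\<lbrakk>exec p s t s'; exec q s' u s''\<rbrakk> \<Longrightarrow> exec (Seq p q) s (1 + t + u) s''"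
| exec_IfTrue: "\<lbrakk>val e s \<noteq> Lf; exec p s t s'\<rbrakk> \<Longrightarrow> exec (If e p q) s (1 + cost e s + t) s'"
| exec_IfFalse: "\<lbrakk>val e s = Lf; exec q s t s'\<rbrakk> \<Longrightarrow> exec (If e p q) s (1 + cost e s + t) s'"
| exec_WhileFalse: "val e s = Lf \<Longrightarrow> exec (While e p) s (1 + cost e s) s"
| exec_WhileTrue: "\<lbrakk>val e s \<noteq> Lf; exec p s t s'; exec (While e p) s' u s''\<rbrakk> \<Longrightarrow>
    exec (While e p) s (1 + cost e s + t + u) s''"

inductive_cases Seq_E: "exec (Seq p q) s t s'"
inductive_cases If_E: "exec (If e p q) s t s'"
inductive_cases While_E: "exec (While e p) s t s'"

lemma exec_deterministic: "exec p s t s' \<Longrightarrow> exec p s u s'' \<Longrightarrow> t = u \<and> s' = s''"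
proof (induction arbitrary: u s'' rule: exec.induct)
  case (exec_Skip s)
  then show ?case by cases simp
next
  case (exec_Assign x e s)
  then show ?case by cases simp
next
  case (exec_Seq p s t s' q u' r)
  from exec_Seq.prems obtain t1 s1 u1
    where "exec p s t1 s1" "exec q s1 u1 s''" "u = Suc (t1 + u1)" by (rule Seq_E) blast
  with exec_Seq.IH(1)[of t1 s1] exec_Seq.IH(2)[of u1 s''] show ?case by simp
next
  case (exec_IfTrue e s p t s' q)
  from exec_IfTrue.prems obtain t1
    where "exec p s t1 s''" "u = Suc (cost e s + t1)" by (rule If_E) (use exec_IfTrue.hyps(1) in blast)+
  with exec_IfTrue.IH[of t1 s''] show ?case by simp
next
  case (exec_IfFalse e s q t s' p)
  from exec_IfFalse.prems obtain t1
    where "exec q s t1 s''" "u = Suc (cost e s + t1)" by (rule If_E) (use exec_IfFalse.hyps(1) in blast)+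
  with exec_IfFalse.IH[of t1 s''] show ?case by simp
next
  case (exec_WhileFalse e s p)
  from exec_WhileFalse.prems exec_WhileFalse.hyps show ?case by cases simp_all
next
  case (exec_WhileTrue e s p t s' u' r)
  from exec_WhileTrue.prems obtain t1 s1 u1
    where "exec p s t1 s1" "exec (While e p) s1 u1 s''" "u = Suc (cost e s + t1 + u1)"
    by (rule While_E) (use exec_WhileTrue.hyps(1) in blast)+
  with exec_WhileTrue.IH(1)[of t1 s1] exec_WhileTrue.IH(2)[of u1 s''] show ?case by simp
qed

text \<open>
  Variable \<open>0\<close> holds the input at the start and the output at the end. \<open>I\<close> is the set of
  instances, and \<open>R x y\<close> says that \<open>y\<close> is a correct answer for the instance \<open>x\<close>.
\<close>

definition initial_store :: "bt \<Rightarrow> store" where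
  "initial_store d = (\<lambda>_. Lf)(0 := d)"

definition poly_time_search ::
  "('a \<Rightarrow> bt) \<Rightarrow> ('b \<Rightarrow> bt) \<Rightarrow> 'a set \<Rightarrow> ('a \<Rightarrow> 'b \<Rightarrow> bool) \<Rightarrow> bool" where
  "poly_time_search enc_in enc_out I R \<longleftrightarrow>
     (\<exists>(p :: com) (q :: nat poly). \<forall>x\<in>I. \<exists>t s y.
        exec p (initial_store (enc_in x)) t s \<and> t \<le> poly q (nodes (enc_in x)) \<and>
        s 0 = enc_out y \<and> R x y)"


section \<open>Encodings\<close>

text \<open>Natural numbers are encoded in binary, least significant digit first.\<close>

fun enc_nat :: "nat \<Rightarrow> bt" where
  "enc_nat n =
     (if n = 0 then Lf else Br (if odd n then Br Lf Lf else Lf) (enc_nat (n div 2)))"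

declare enc_nat.simps [simp del]

fun enc_list :: "('a \<Rightarrow> bt) \<Rightarrow> 'a list \<Rightarrow> bt" where
  "enc_list f [] = Lf"
| "enc_list f (x # xs) = Br (f x) (enc_list f xs)"

fun enc_pair :: "('a \<Rightarrow> bt) \<Rightarrow> ('b \<Rightarrow> bt) \<Rightarrow> 'a \<times> 'b \<Rightarrow> bt" where
  "enc_pair f g (x, y) = Br (f x) (g y)"

fun enc_option :: "('a \<Rightarrow> bt) \<Rightarrow> 'a option \<Rightarrow> bt" where
  "enc_option f None = Lf"
| "enc_option f (Some x) = Br (f x) Lf"


section \<open>The coalition manipulation problem\<close>

text \<open>
  Teams are named by arbitrary natural numbers. The finite sets \<open>E\<close> and \<open>C\<close> are given by lists
  of their elements, in any order; the set of teams is the set of the ranked teams.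
\<close>

record cup_instance =
  ranking :: "nat list"
  games :: "(nat \<times> nat) list"
  coalition :: "nat list"
  favourite :: nat

definition cup_instance :: "cup_instance \<Rightarrow> bool" where
  "cup_instance X \<longleftrightarrow>
     distinct (ranking X) \<and>
     tournament (set (ranking X)) (set (games X)) \<and>
     set (coalition X) \<subseteq> set (ranking X) \<and>
     favourite X \<in> set (ranking X)"

definition enc_instance :: "cup_instance \<Rightarrow> bt" where
  "enc_instance X =
     Br (enc_list enc_nat (ranking X))
       (Br (enc_list (enc_pair enc_nat enc_nat) (games X))
         (Br (enc_list enc_nat (coalition X)) (enc_nat (favourite X))))"

definition successful :: "cup_instance \<Rightarrow> nat rel \<Rightarrow> bool" where
  "successful X M \<longleftrightarrow>
     manipulations_by (set (coalition X)) (set (games X)) M \<and>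
     wins_cup (manipulate (set (games X)) M) (ranking X) (favourite X)"

definition correct_answer :: "cup_instance \<Rightarrow> (nat \<times> nat) list option \<Rightarrow> bool" where
  "correct_answer X a \<longleftrightarrow>
     (case a of
        Some ms \<Rightarrow> successful X (set ms)
      | None \<Rightarrow> (\<nexists>M. successful X M))"

end

theory Submission
  imports Defs
begin

text \<open>
  A coalition member that throws a game is eliminated, so only one of its manipulations matters.
  Hence some successful set of manipulations, if there is one, has at most \<open>c\<close> elements, and all
  lists of at most \<open>c\<close> games, polynomially many, can be tried by simulating the cup. Polynomial
  time is shown compositionally: the functions computed in polynomial time are closed under
  composition, case distinction, and folds whose intermediate results stay polynomially small.
\<close>

section \<open>Polynomial-time functions on trees\<close>

text \<open>The constant \<open>c\<close> is never an input of a program: for each bound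
  \<open>k\<close> there is a separate program, obtained by induction on \<open>k\<close>, that
  lists the \<open>(1 + g) ^ k\<close> candidates over the \<open>g\<close> games that coalition
  members would win. This puts \<open>c\<close> into the exponent, which is why it has to be fixed.
  Smallness of intermediate results must be demanded because a fold may double its accumulator in
  every step; nearly all folds here add only a polynomial amount per step. The language has no
  arithmetic, so counts are kept in unary as lengths of lists, which is harmless because none is
  much larger than the number of teams. Team names are never decoded: the cup is run on their
  encodings, and its invariance under renaming carries the result back.\<close>

definition psize :: "(bt \<Rightarrow> nat) \<Rightarrow> bool" where
  "psize g \<longleftrightarrow> (\<exists>q :: nat poly. \<forall>d. g d \<le> poly q (nodes d))"

text \<open>Natural coefficients are nonnegative, so a bound on the size of an argument may be
  substituted into a polynomial time bound.\<close>

lemma poly_nat_mono: "a \<le> b \<Longrightarrow> poly (q :: nat poly) a \<le> poly q b"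
  by (induction q) (auto intro!: add_mono mult_mono)

lemma psize_mono: "psize g \<Longrightarrow> (\<And>d. f d \<le> g d) \<Longrightarrow> psize f"
  unfolding psize_def by (meson le_trans)

lemma psize_const: "psize (\<lambda>_. k)"
  unfolding psize_def by (rule exI[of _ "[:k:]"]) simp

lemma psize_nodes: "psize nodes"
  unfolding psize_def by (rule exI[of _ "[:0, 1:]"]) simp

lemma psize_add: "psize f \<Longrightarrow> psize g \<Longrightarrow> psize (\<lambda>d. f d + g d)"
  unfolding psize_def by (metis add_mono poly_add)

lemma psize_mult: "psize f \<Longrightarrow> psize g \<Longrightarrow> psize (\<lambda>d. f d * g d)"
  unfolding psize_def by (metis mult_le_mono poly_mult)

lemma psize_poly: "psize g \<Longrightarrow> psize (\<lambda>d. poly q (g d))"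
  unfolding psize_def by (metis poly_nat_mono poly_pcompose)

lemma psize_Suc: "psize f \<Longrightarrow> psize (\<lambda>d. Suc (f d))"
  using psize_add[OF _ psize_const[of 1]] by simp

lemmas psize_intros = psize_const psize_Suc psize_nodes psize_add psize_mult psize_poly

text \<open>Termination is part of the claim and the postcondition sees the elapsed time, so the
  rules below execute a program symbolically while its running time accumulates.\<close>

definition wp :: "com \<Rightarrow> store \<Rightarrow> (nat \<Rightarrow> store \<Rightarrow> bool) \<Rightarrow> bool" where
  "wp p s Q \<longleftrightarrow> (\<exists>t s'. exec p s t s' \<and> Q t s')"

lemma wp_Assign: "Q (1 + cost e s) (s(x := val e s)) \<Longrightarrow> wp (Assign x e) s Q"
  unfolding wp_def by (blast intro: exec_Assign)

lemma wp_Seq: "wp p s (\<lambda>t s'. wp q s' (\<lambda>u. Q (1 + t + u))) \<Longrightarrow> wp (Seq p q) s Q"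
  unfolding wp_def by (blast intro: exec_Seq)

lemma wp_If:
  assumes "val e s \<noteq> Lf \<Longrightarrow> wp p s (\<lambda>t. Q (1 + cost e s + t))"
    and "val e s = Lf \<Longrightarrow> wp q s (\<lambda>t. Q (1 + cost e s + t))"
  shows "wp (If e p q) s Q"
  using assms unfolding wp_def by (cases "val e s = Lf") (blast intro: exec_IfTrue exec_IfFalse)+

lemma wp_While_False: "val e s = Lf \<Longrightarrow> Q (1 + cost e s) s \<Longrightarrow> wp (While e p) s Q"
  unfolding wp_def by (blast intro: exec_WhileFalse)

lemma wp_While_True:
  "val e s \<noteq> Lf \<Longrightarrow> wp p s (\<lambda>t s'. wp (While e p) s' (\<lambda>u. Q (1 + cost e s + t + u))) \<Longrightarrow>
    wp (While e p) s Q"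
  unfolding wp_def by (blast intro: exec_WhileTrue)

lemma wp_mono: "wp p s Q \<Longrightarrow> (\<And>t s'. Q t s' \<Longrightarrow> Q' t s') \<Longrightarrow> wp p s Q'"
  unfolding wp_def by blast

text \<open>
  A program for \<open>f\<close> must work in every store, and may change only the variables up to some \<open>N\<close>;
  so the variables above \<open>N\<close> can be used to save values across a call.
\<close>

definition computes :: "com \<Rightarrow> nat \<Rightarrow> (bt \<Rightarrow> nat) \<Rightarrow> (bt \<Rightarrow> bt) \<Rightarrow> bool" where
  "computes p N T f \<longleftrightarrow>
     (\<forall>s. wp p s (\<lambda>t s'. t \<le> T (s 0) \<and> s' 0 = f (s 0) \<and> (\<forall>x>N. s' x = s x)))"

text \<open>The bound on the size of the value is carried along for the sake of composition: the
  second program is polynomial in the size of the intermediate value, which must in turn be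
  polynomial in the input.\<close>

definition ptime :: "(bt \<Rightarrow> bt) \<Rightarrow> bool" where
  "ptime f \<longleftrightarrow> psize (\<lambda>d. nodes (f d)) \<and> (\<exists>p N T. psize T \<and> computes p N T f)"

lemma ptimeI:
  assumes "\<And>s. wp p s (\<lambda>t s'. t \<le> T (s 0) \<and> s' 0 = f (s 0) \<and> (\<forall>x>N. s' x = s x))"
    and "psize (\<lambda>d. nodes (f d))" "psize T"
  shows "ptime f"
  using assms unfolding ptime_def computes_def by blast

lemma ptime_psize: "ptime f \<Longrightarrow> psize (\<lambda>d. nodes (f d))"
  unfolding ptime_def by blast

lemma wp_computes:
  assumes "computes p N T f"
    and "\<And>t s'. t \<le> T (s 0) \<Longrightarrow> s' 0 = f (s 0) \<Longrightarrow> (\<And>x. x > N \<Longrightarrow> s' x = s x) \<Longrightarrow> Q t s'"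
  shows "wp p s Q"
  by (rule wp_mono[OF assms(1)[unfolded computes_def, rule_format]]) (use assms(2) in blast)

lemma ptimeE:
  assumes "ptime f"
  obtains p N q where "computes p N (\<lambda>d. poly q (nodes d)) f"
proof -
  from assms obtain p N T where T: "psize T" and p: "computes p N T f"
    unfolding ptime_def by blast
  from T obtain q where q: "\<And>d. T d \<le> poly q (nodes d)" unfolding psize_def by blast
  have "computes p N (\<lambda>d. poly q (nodes d)) f"
    unfolding computes_def by (intro allI wp_computes[OF p]) (use q le_trans in blast)
  then show ?thesis by (rule that)
qed

lemma psize_comp: "psize g \<Longrightarrow> ptime f \<Longrightarrow> psize (\<lambda>d. g (f d))"
proof -
  assume "psize g" "ptime f"
  then obtain q r where q: "\<And>d. g d \<le> poly q (nodes d)" and r: "\<And>d. nodes (f d) \<le> poly r (nodes d)"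
    unfolding psize_def ptime_def by blast
  have "psize (\<lambda>d. poly q (poly r (nodes d)))" by (intro psize_intros)
  then show ?thesis
    by (rule psize_mono) (meson q r le_trans poly_nat_mono)
qed

lemma ptime_assign:
  assumes "\<And>s. val e s = f (s 0)" "\<And>s. cost e s \<le> T (s 0)" "psize T" "psize (\<lambda>d. nodes (f d))"
  shows "ptime f"
proof (rule ptimeI)
  show "wp (Assign 0 e) s (\<lambda>t s'. t \<le> 1 + T (s 0) \<and> s' 0 = f (s 0) \<and> (\<forall>x>0. s' x = s x))" for s
    by (rule wp_Assign) (use assms in simp)
qed (intro psize_intros assms)+

lemma nodes_hd: "nodes (hd_bt d) \<le> nodes d" and nodes_tl: "nodes (tl_bt d) \<le> nodes d"
  by (cases d; simp)+

lemma ptime_id: "ptime (\<lambda>d. d)"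
  by (rule ptime_assign[where e = "Var 0" and T = nodes]) (simp_all add: psize_nodes)

lemma ptime_Lf: "ptime (\<lambda>d. Lf)"
  by (rule ptime_assign[where e = "Nil_E" and T = "\<lambda>_. 1"]) (simp_all add: psize_const)

lemma ptime_comp: "ptime f \<Longrightarrow> ptime g \<Longrightarrow> ptime (\<lambda>d. f (g d))"
proof -
  assume f: "ptime f" and g: "ptime g"
  from f obtain p N q where p: "computes p N (\<lambda>d. poly q (nodes d)) f" by (rule ptimeE)
  from g obtain p' N' q' where p': "computes p' N' (\<lambda>d. poly q' (nodes d)) g" by (rule ptimeE)
  show "ptime (\<lambda>d. f (g d))"
  proof (rule ptimeI)
    show "wp (Seq p' p) s (\<lambda>t s'. t \<le> 1 + poly q' (nodes (s 0)) + poly q (nodes (g (s 0))) \<and>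
        s' 0 = f (g (s 0)) \<and> (\<forall>x>max N N'. s' x = s x))" for s
      by (rule wp_Seq, rule wp_computes[OF p'], rule wp_computes[OF p]) auto
  qed (intro psize_intros psize_comp[OF _ g] ptime_psize[OF f])+
qed

lemma ptime_hd: "ptime f \<Longrightarrow> ptime (\<lambda>d. hd_bt (f d))"
  and ptime_tl: "ptime f \<Longrightarrow> ptime (\<lambda>d. tl_bt (f d))"
proof -
  have "ptime hd_bt"
    by (rule ptime_assign[where e = "Hd_E (Var 0)" and T = "\<lambda>d. nodes d + nodes d"])
      (auto intro: psize_add psize_nodes psize_mono[OF psize_nodes nodes_hd] nodes_hd)
  then show "ptime f \<Longrightarrow> ptime (\<lambda>d. hd_bt (f d))" by (rule ptime_comp)
  have "ptime tl_bt"
    by (rule ptime_assign[where e = "Tl_E (Var 0)" and T = "\<lambda>d. nodes d + nodes d"])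
      (auto intro: psize_add psize_nodes psize_mono[OF psize_nodes nodes_tl] nodes_tl)
  then show "ptime f \<Longrightarrow> ptime (\<lambda>d. tl_bt (f d))" by (rule ptime_comp)
qed

text \<open>The first program may destroy the input, and the second one the first result. Both are
  therefore saved in variables above \<open>N\<close> and \<open>N'\<close>, and the input is
  restored in between.\<close>

lemma ptime_Br: "ptime f \<Longrightarrow> ptime g \<Longrightarrow> ptime (\<lambda>d. Br (f d) (g d))"
proof -
  assume f: "ptime f" and g: "ptime g"
  from f obtain p N q where p: "computes p N (\<lambda>d. poly q (nodes d)) f" by (rule ptimeE)
  from g obtain p' N' q' where p': "computes p' N' (\<lambda>d. poly q' (nodes d)) g" by (rule ptimeE)
  define a where "a = Suc (max N N')"
  have a: "N < a" "N' < a" "N < Suc a" "N' < Suc a" "a \<noteq> 0" "\<And>x. a < x \<Longrightarrow> N < x \<and> N' < x"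
    by (auto simp: a_def)
  define P where "P = Seq (Assign a (Var 0)) (Seq p (Seq (Assign (Suc a) (Var 0)) (Seq (Assign 0 (Var a))
    (Seq p' (Assign 0 (Cons_E (Var (Suc a)) (Var 0)))))))"
  \<comment> \<open>The input is copied twice, each value is paid for at most three times (saved,
    read, part of the new pair), and 20 generously covers the unit costs.\<close>
  define T where "T = (\<lambda>d. 20 + 2 * nodes d + poly q (nodes d) + poly q' (nodes d)
    + 3 * nodes (f d) + 3 * nodes (g d))"
  show "ptime (\<lambda>d. Br (f d) (g d))"
  proof (rule ptimeI)
    show "wp P s (\<lambda>t s'. t \<le> T (s 0) \<and> s' 0 = Br (f (s 0)) (g (s 0)) \<and> (\<forall>x>Suc a. s' x = s x))" for s
      unfolding P_def
      by (rule wp_Seq, rule wp_Assign, rule wp_Seq, rule wp_computes[OF p], rule wp_Seq, rule wp_Assign,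
          rule wp_Seq, rule wp_Assign, rule wp_Seq, rule wp_computes[OF p'], rule wp_Assign)
        (use a in \<open>auto simp: T_def\<close>)
    show "psize T"
      unfolding T_def by (intro psize_intros ptime_psize f g)
    have "psize (\<lambda>d. 1 + nodes (f d) + nodes (g d))" by (intro psize_intros ptime_psize f g)
    then show "psize (\<lambda>d. nodes (Br (f d) (g d)))" by simp
  qed
qed

text \<open>Truth values are those of \<open>Eq_E\<close>, so a decision can serve directly as a
  condition.\<close>

definition pdec :: "(bt \<Rightarrow> bool) \<Rightarrow> bool" where
  "pdec P \<longleftrightarrow> ptime (\<lambda>d. if P d then Br Lf Lf else Lf)"

lemma ptime_If: "pdec P \<Longrightarrow> ptime f \<Longrightarrow> ptime g \<Longrightarrow> ptime (\<lambda>d. if P d then f d else g d)"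
proof -
  assume P: "pdec P" and f: "ptime f" and g: "ptime g"
  from P[unfolded pdec_def] obtain r M u
    where r: "computes r M (\<lambda>d. poly u (nodes d)) (\<lambda>d. if P d then Br Lf Lf else Lf)" by (rule ptimeE)
  from f obtain p N q where p: "computes p N (\<lambda>d. poly q (nodes d)) f" by (rule ptimeE)
  from g obtain p' N' q' where p': "computes p' N' (\<lambda>d. poly q' (nodes d)) g" by (rule ptimeE)
  define a where "a = Suc (max M (max N N'))"
  have a: "M < a" "N < a" "N' < a" "M < Suc a" "a \<noteq> 0" "\<And>x. Suc a < x \<Longrightarrow> M < x \<and> N < x \<and> N' < x"
    by (auto simp: a_def)
  define S where "S = Seq (Assign a (Var 0)) (Seq r (Seq (Assign (Suc a) (Var 0)) (Seq (Assign 0 (Var a))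
    (If (Var (Suc a)) p p'))))"
  define T where "T = (\<lambda>d. 20 + 2 * nodes d + poly q (nodes d) + poly q' (nodes d) + poly u (nodes d))"
  show "ptime (\<lambda>d. if P d then f d else g d)"
  proof (rule ptimeI)
    show "wp S s (\<lambda>t s'. t \<le> T (s 0) \<and> s' 0 = (if P (s 0) then f (s 0) else g (s 0)) \<and>
        (\<forall>x>Suc a. s' x = s x))" for s
      unfolding S_def
      by (rule wp_Seq, rule wp_Assign, rule wp_Seq, rule wp_computes[OF r], rule wp_Seq, rule wp_Assign,
          rule wp_Seq, rule wp_Assign, rule wp_If; (rule wp_computes[OF p] wp_computes[OF p'])?)
        (use a in \<open>auto simp: T_def split: if_splits\<close>)
    show "psize T" unfolding T_def by (intro psize_intros)
    have "psize (\<lambda>d. nodes (f d) + nodes (g d))" by (intro psize_intros ptime_psize f g)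
    then show "psize (\<lambda>d. nodes (if P d then f d else g d))" by (rule psize_mono) simp
  qed
qed

text \<open>A program receives a single tree, so the equality test is applied to the two components
  of a pair, and the pair of \<open>f d\<close> and \<open>g d\<close> is then substituted.\<close>

lemma pdec_eq: "ptime f \<Longrightarrow> ptime g \<Longrightarrow> pdec (\<lambda>d. f d = g d)"
proof -
  assume f: "ptime f" and g: "ptime g"
  have "nodes (hd_bt d) + nodes (tl_bt d) \<le> 2 * nodes d" for d
    using nodes_hd[of d] nodes_tl[of d] by simp
  then have "ptime (\<lambda>d. if hd_bt d = tl_bt d then Br Lf Lf else Lf)"
  proof (intro ptime_assign[where e = "Eq_E (Hd_E (Var 0)) (Tl_E (Var 0))" and T = "\<lambda>d. 3 + 4 * nodes d"])
    show "psize (\<lambda>d. nodes (if hd_bt d = tl_bt d then Br Lf Lf else Lf))"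
      by (rule psize_mono[OF psize_const[of 3]]) simp
    show "psize (\<lambda>d. 3 + 4 * nodes d)" by (intro psize_intros)
    show "cost (Eq_E (Hd_E (Var 0)) (Tl_E (Var 0))) s \<le> 3 + 4 * nodes (s 0)" for s
      using nodes_hd[of "s 0"] nodes_tl[of "s 0"] by simp
  qed simp
  from ptime_comp[OF this ptime_Br[OF f g]] show ?thesis by (simp add: pdec_def)
qed

lemma pdec_not: "pdec P \<Longrightarrow> pdec (\<lambda>d. \<not> P d)"
proof -
  assume "pdec P"
  then have "ptime (\<lambda>d. if P d then Lf else Br Lf Lf)"
    by (intro ptime_If ptime_Br ptime_Lf)
  moreover have "(\<lambda>d. if P d then Lf else Br Lf Lf) = (\<lambda>d. if \<not> P d then Br Lf Lf else Lf)" by auto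
  ultimately show ?thesis by (simp add: pdec_def)
qed

lemma pdec_conj: "pdec P \<Longrightarrow> pdec Q \<Longrightarrow> pdec (\<lambda>d. P d \<and> Q d)"
proof -
  assume "pdec P" "pdec Q"
  then have "ptime (\<lambda>d. if P d then if Q d then Br Lf Lf else Lf else Lf)"
    by (intro ptime_If ptime_Br ptime_Lf)
  moreover have "(\<lambda>d. if P d then if Q d then Br Lf Lf else Lf else Lf) = (\<lambda>d. if P d \<and> Q d then Br Lf Lf else Lf)" by auto
  ultimately show ?thesis by (simp add: pdec_def)
qed

lemma pdec_disj: "pdec P \<Longrightarrow> pdec Q \<Longrightarrow> pdec (\<lambda>d. P d \<or> Q d)"
  using pdec_not[OF pdec_conj[OF pdec_not pdec_not], of P Q] by simp

lemma pdec_comp: "pdec P \<Longrightarrow> ptime f \<Longrightarrow> pdec (\<lambda>d. P (f d))"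
  unfolding pdec_def by (rule ptime_comp)

text \<open>Functions of several arguments are treated as functions of nested pairs, read off by
  \<open>hd_bt\<close> and \<open>tl_bt\<close>; premises about step functions below have this
  form.\<close>

lemma ptime_comp2:
  "ptime (\<lambda>z. h (hd_bt z) (tl_bt z)) \<Longrightarrow> ptime f \<Longrightarrow> ptime g \<Longrightarrow> ptime (\<lambda>d. h (f d) (g d))"
  using ptime_comp[OF _ ptime_Br] by fastforce

section \<open>Polynomial-time functions on lists\<close>

text \<open>Every tree is the list of left subtrees along its right spine. Hence
  \<open>items\<close> and \<open>tree_of\<close> are mutually inverse, and no tree is malformed as
  a list.\<close>

fun items :: "bt \<Rightarrow> bt list" where
  "items Lf = []"
| "items (Br a b) = a # items b"

abbreviation tree_of :: "bt list \<Rightarrow> bt" where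
  "tree_of \<equiv> enc_list (\<lambda>t. t)"

lemma items_tree_of [simp]: "items (tree_of xs) = xs"
  by (induction xs) auto

lemma tree_of_items [simp]: "tree_of (items t) = t"
  by (induction t) auto

lemma enc_list_eq_tree_of: "enc_list f xs = tree_of (map f xs)"
  by (induction xs) auto

lemma tree_of_tl: "tree_of (tl xs) = tl_bt (tree_of xs)"
  by (cases xs) auto

lemma nodes_tree_of: "nodes (tree_of xs) = 1 + length xs + sum_list (map nodes xs)"
  by (induction xs) auto

lemma nodes_item: "a \<in> set xs \<Longrightarrow> nodes a \<le> nodes (tree_of xs)"
  by (induction xs) auto

definition plist :: "(bt \<Rightarrow> bt list) \<Rightarrow> bool" where
  "plist L \<longleftrightarrow> ptime (\<lambda>d. tree_of (L d))"

section \<open>Folds as the only source of loops\<close>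

lemma wp_fold_loop:
  fixes h :: "bt \<Rightarrow> bt \<Rightarrow> bt \<Rightarrow> bt"
  assumes p: "computes p N (\<lambda>z. poly q (nodes z)) (\<lambda>z. h (hd_bt z) (hd_bt (tl_bt z)) (tl_bt (tl_bt z)))"
  defines "e \<equiv> Suc N" and "l \<equiv> Suc (Suc N)"
  defines "W \<equiv> While (Var l) (Seq (Assign 0 (Cons_E (Var e) (Cons_E (Hd_E (Var l)) (Var 0))))
    (Seq p (Assign l (Tl_E (Var l)))))"
  assumes "s e = d" "s l = tree_of xs" "nodes d \<le> B" "nodes (tree_of xs) \<le> B"
    and "\<And>ys zs. xs = ys @ zs \<Longrightarrow> nodes (fold (h d) ys (s 0)) \<le> B"
  shows "wp W s (\<lambda>t s'. t \<le> (length xs + 1) * (poly q (3 * B + 2) + 20 * B + 20) \<and>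
    s' 0 = fold (h d) xs (s 0) \<and> (\<forall>x>l. s' x = s x))"
  using assms(5-)
proof (induction xs arbitrary: s)
  case Nil
  show ?case
    unfolding W_def by (rule wp_While_False) (use Nil in auto)
next
  case (Cons a xs)
  let ?K = "poly q (3 * B + 2) + 20 * B + 20"
  have l: "l \<noteq> 0" "e \<noteq> 0" "e \<noteq> l" "N < e" "N < l" by (auto simp: e_def l_def)
  have d: "nodes (s e) \<le> B" and acc: "nodes (s 0) \<le> B" and a: "nodes a + nodes (tree_of xs) < B"
    using Cons.prems(1) Cons.prems(3) Cons.prems(5)[of "[]"] Cons.prems(4) by auto
  let ?s = "s(0 := Br (s e) (Br a (s 0)))"
  have q: "poly q (nodes (?s 0)) \<le> poly q (3 * B + 2)"
    using d acc a by (intro poly_nat_mono) simp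
  have IH: "wp W (s'(l := tree_of xs)) (\<lambda>t s''. t \<le> (length xs + 1) * ?K \<and>
      s'' 0 = fold (h d) xs (h d a (s 0)) \<and> (\<forall>x>l. s'' x = s x))"
    if "s' 0 = h d a (s 0)" "\<And>x. x > N \<Longrightarrow> s' x = ?s x" for s'
    by (rule wp_mono[OF Cons.IH[of "s'(l := tree_of xs)"]])
      (use that l Cons.prems(1,3,4) Cons.prems(5)[of "a # _"] in \<open>auto simp: l_def e_def\<close>)
  show ?case
    unfolding W_def
    apply (rule wp_While_True)
     apply (simp add: Cons.prems(2))
    apply (rule wp_Seq, rule wp_Assign, rule wp_Seq, rule wp_computes[OF p], rule wp_Assign)
    apply (unfold W_def[symmetric])
    subgoal premises prems for t s'
    proof -
      have s': "s' 0 = h d a (s 0)" "\<And>x. x > N \<Longrightarrow> s' x = ?s x" and t: "t \<le> poly q (nodes (?s 0))"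
        using prems Cons.prems(1,2) by auto
      have "s' l = Br a (tree_of xs)" using s'(2)[of l] l Cons.prems(2) by simp
      then have eq: "s'(l := val (Tl_E (Var l)) s') = s'(l := tree_of xs)"
        and c: "cost (Tl_E (Var l)) s' \<le> 2 * B" using a by auto
      have c': "cost (Cons_E (Var e) (Cons_E (Hd_E (Var l)) (Var 0))) s \<le> 12 * B + 4"
        "cost (Var l) s \<le> B"
        using d acc a Cons.prems(2,4) by auto
      show ?thesis
        unfolding eq by (rule wp_mono[OF IH[OF s']]) (use t q c c' in \<open>auto simp: algebra_simps\<close>)
    qed
    done
qed

text \<open>The step function also receives the whole input \<open>d\<close>, so it can use data
  outside the list. The bound \<open>S\<close> on the accumulator after every prefix is essential:
  without it, a step such as doubling would lead to exponential size. In the loop it bounds the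
  argument \<open>Br d (Br a w)\<close> of the step by \<open>3 * B + 2\<close>.\<close>

lemma ptime_fold:
  assumes L: "plist L" and A: "ptime A"
    and h: "ptime (\<lambda>z. h (hd_bt z) (hd_bt (tl_bt z)) (tl_bt (tl_bt z)))"
    and S: "psize S"
    and bound: "\<And>d xs ys. L d = xs @ ys \<Longrightarrow> nodes (fold (h d) xs (A d)) \<le> S d"
  shows "ptime (\<lambda>d. fold (h d) (L d) (A d))"
proof -
  have "ptime (\<lambda>d. Br d (Br (tree_of (L d)) (A d)))"
    using L unfolding plist_def by (intro ptime_Br ptime_id A)
  then obtain p0 N0 q0
    where p0: "computes p0 N0 (\<lambda>d. poly q0 (nodes d)) (\<lambda>d. Br d (Br (tree_of (L d)) (A d)))"
    by (rule ptimeE)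
  from h obtain p N q where p: "computes p N (\<lambda>d. poly q (nodes d))
      (\<lambda>z. h (hd_bt z) (hd_bt (tl_bt z)) (tl_bt (tl_bt z)))" by (rule ptimeE)
  \<comment> \<open>The loop variables must lie above those of the step program; the maximum also
    places the variables of the preparing program \<open>p0\<close> below \<open>l\<close>, so that
    nothing above \<open>l\<close> changes.\<close>
  define M where "M = max N N0"
  from p have p: "computes p M (\<lambda>d. poly q (nodes d))
      (\<lambda>z. h (hd_bt z) (hd_bt (tl_bt z)) (tl_bt (tl_bt z)))"
    unfolding computes_def M_def
    by (intro allI, intro wp_mono[OF p[unfolded computes_def, rule_format]]) auto
  define e l where "e = Suc M" and "l = Suc (Suc M)"
  define W where "W = While (Var l) (Seq (Assign 0 (Cons_E (Var e) (Cons_E (Hd_E (Var l)) (Var 0))))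
    (Seq p (Assign l (Tl_E (Var l)))))"
  define P where "P = Seq p0 (Seq (Assign e (Hd_E (Var 0))) (Seq (Assign l (Hd_E (Tl_E (Var 0))))
    (Seq (Assign 0 (Tl_E (Tl_E (Var 0)))) W)))"
  define B where "B = (\<lambda>d. nodes d + nodes (tree_of (L d)) + nodes (A d) + S d)"
  define T where "T = (\<lambda>d. poly q0 (nodes d) + (B d + 1) * (poly q (3 * B d + 2) + 20 * B d + 20)
    + 20 * B d + 30)"
  show ?thesis
  proof (rule ptimeI)
    fix s :: store
    have loop: "wp W s' (\<lambda>t s''. t \<le> (length (L (s 0)) + 1) * (poly q (3 * B (s 0) + 2) + 20 * B (s 0) + 20) \<and>
      s'' 0 = fold (h (s 0)) (L (s 0)) (A (s 0)) \<and> (\<forall>x>l. s'' x = s' x))"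
      if "s' 0 = A (s 0)" "s' e = s 0" "s' l = tree_of (L (s 0))" for s'
      by (rule wp_mono[OF wp_fold_loop[OF p, of s' "s 0" "L (s 0)" "B (s 0)", folded e_def l_def, folded W_def]])
        (use that bound[of "s 0"] in \<open>auto simp: B_def intro: trans_le_add2\<close>)
    have "length (L (s 0)) + 1 \<le> B (s 0) + 1" by (simp add: B_def nodes_tree_of)
    from mult_le_mono1[OF this] have len: "t \<le> (length (L (s 0)) + 1) * k \<Longrightarrow> t \<le> (B (s 0) + 1) * k" for t k
      by (meson le_trans)
    have loop': "wp W s' (\<lambda>t s''. t \<le> (B (s 0) + 1) * (poly q (3 * B (s 0) + 2) + 20 * B (s 0) + 20) \<and>
      s'' 0 = fold (h (s 0)) (L (s 0)) (A (s 0)) \<and> (\<forall>x>l. s'' x = s' x))"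
      if "s' 0 = A (s 0)" "s' e = s 0" "s' l = tree_of (L (s 0))" for s'
      by (rule wp_mono[OF loop[OF that]]) (use len in blast)
    show "wp P s (\<lambda>t s'. t \<le> T (s 0) \<and> s' 0 = fold (h (s 0)) (L (s 0)) (A (s 0)) \<and> (\<forall>x>l. s' x = s x))"
      unfolding P_def
      by (rule wp_Seq, rule wp_computes[OF p0], rule wp_Seq, rule wp_Assign, rule wp_Seq, rule wp_Assign,
          rule wp_Seq, rule wp_Assign, rule wp_mono[OF loop'])
        (auto simp: e_def l_def T_def B_def M_def)
  next
    have B: "psize B" unfolding B_def using L A S unfolding plist_def by (intro psize_intros ptime_psize)
    show "psize T" unfolding T_def by (intro psize_intros B)
    show "psize (\<lambda>d. nodes (fold (h d) (L d) (A d)))"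
      by (rule psize_mono[OF S]) (simp add: bound[of _ _ "[]"])
  qed
qed

text \<open>If each step adds at most \<open>S d\<close> nodes, the accumulator never exceeds its
  initial size by more than the length of the list times \<open>S d\<close>.\<close>

lemma ptime_fold_additive:
  assumes L: "plist L" and A: "ptime A"
    and h: "ptime (\<lambda>z. h (hd_bt z) (hd_bt (tl_bt z)) (tl_bt (tl_bt z)))"
    and S: "psize S"
    and bound: "\<And>d a w. a \<in> set (L d) \<Longrightarrow> nodes (h d a w) \<le> nodes w + S d"
  shows "ptime (\<lambda>d. fold (h d) (L d) (A d))"
proof (rule ptime_fold[OF L A h])
  show "psize (\<lambda>d. nodes (A d) + nodes (tree_of (L d)) * S d)"
    using L A unfolding plist_def by (intro psize_intros ptime_psize S)
  fix d xs ys
  assume d: "L d = xs @ ys"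
  have "nodes (fold (h d) xs w) \<le> nodes w + length xs * S d" if "set xs \<subseteq> set (L d)" for xs w
    using that
  proof (induction xs arbitrary: w)
    case (Cons a xs)
    then have "nodes (fold (h d) xs (h d a w)) \<le> nodes (h d a w) + length xs * S d" by simp
    also have "nodes (h d a w) \<le> nodes w + S d" using Cons.prems bound by simp
    finally show ?case by simp
  qed simp
  from this[of xs "A d"] d have "nodes (fold (h d) xs (A d)) \<le> nodes (A d) + length xs * S d" by simp
  also have "length xs \<le> nodes (tree_of (L d))" by (simp add: d nodes_tree_of)
  finally show "nodes (fold (h d) xs (A d)) \<le> nodes (A d) + nodes (tree_of (L d)) * S d" by simp
qed

lemma plist_psize: "plist L \<Longrightarrow> psize (\<lambda>d. nodes (tree_of (L d)))"
  unfolding plist_def by (rule ptime_psize)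

lemma plist_comp: "plist L \<Longrightarrow> ptime f \<Longrightarrow> plist (\<lambda>d. L (f d))"
  unfolding plist_def by (rule ptime_comp)

lemma plist_comp2:
  "plist (\<lambda>z. h (hd_bt z) (tl_bt z)) \<Longrightarrow> ptime f \<Longrightarrow> ptime g \<Longrightarrow> plist (\<lambda>d. h (f d) (g d))"
  unfolding plist_def using ptime_comp2[of "\<lambda>a b. tree_of (h a b)"] .

lemma plist_items: "ptime f \<Longrightarrow> plist (\<lambda>d. items (f d))"
  unfolding plist_def by simp

lemma ptime_tree_of: "plist L \<Longrightarrow> ptime (\<lambda>d. tree_of (L d))"
  unfolding plist_def .

lemma plist_Nil: "plist (\<lambda>d. [])"
  unfolding plist_def by (simp add: ptime_Lf)

lemma plist_Cons: "ptime f \<Longrightarrow> plist L \<Longrightarrow> plist (\<lambda>d. f d # L d)"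
  unfolding plist_def by (simp add: ptime_Br)

lemma plist_tl: "plist L \<Longrightarrow> plist (\<lambda>d. tl (L d))"
  unfolding plist_def by (simp add: tree_of_tl ptime_tl)

lemma plist_If: "pdec P \<Longrightarrow> plist L \<Longrightarrow> plist K \<Longrightarrow> plist (\<lambda>d. if P d then L d else K d)"
  unfolding plist_def by (simp add: if_distrib[of tree_of] ptime_If cong: if_cong)

lemma pdec_eq_list: "plist L \<Longrightarrow> plist K \<Longrightarrow> pdec (\<lambda>d. L d = K d)"
proof -
  assume "plist L" "plist K"
  moreover have "L d = K d \<longleftrightarrow> tree_of (L d) = tree_of (K d)" for d by (metis items_tree_of)
  ultimately show ?thesis by (simp add: plist_def pdec_eq)
qed

lemmas ptime_intros = ptime_id ptime_Lf ptime_hd ptime_tl ptime_Br ptime_If ptime_tree_of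
  pdec_eq pdec_not pdec_conj pdec_disj plist_items plist_Nil plist_Cons plist_tl plist_If pdec_eq_list

section \<open>Closure under list operations\<close>

lemma plist_rev: "plist L \<Longrightarrow> plist (\<lambda>d. rev (L d))"
proof -
  assume L: "plist L"
  have "fold Br xs (tree_of ys) = tree_of (rev xs @ ys)" for xs ys
  proof (induction xs arbitrary: ys)
    case (Cons x xs)
    from Cons.IH[of "x # ys"] show ?case by simp
  qed simp
  from this[of _ "[]"] have "(\<lambda>d. tree_of (rev (L d))) = (\<lambda>d. fold Br (L d) Lf)" by simp
  moreover have "ptime (\<lambda>d. fold Br (L d) Lf)"
    by (rule ptime_fold_additive[where S = "\<lambda>d. 1 + nodes (tree_of (L d))"])
      (auto intro!: L ptime_intros psize_intros plist_psize nodes_item)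
  ultimately show ?thesis by (simp add: plist_def)
qed

lemma plist_append: "plist L \<Longrightarrow> plist K \<Longrightarrow> plist (\<lambda>d. L d @ K d)"
proof -
  assume L: "plist L" and K: "plist K"
  have "fold Br (rev xs) (tree_of ys) = tree_of (xs @ ys)" for xs ys
    by (induction xs arbitrary: ys) auto
  then have "(\<lambda>d. tree_of (L d @ K d)) = (\<lambda>d. fold Br (rev (L d)) (tree_of (K d)))" by simp
  moreover have "ptime (\<lambda>d. fold Br (rev (L d)) (tree_of (K d)))"
    by (rule ptime_fold_additive[where S = "\<lambda>d. 1 + nodes (tree_of (L d))"])
      (auto intro!: plist_rev L K ptime_intros psize_intros plist_psize nodes_item)
  ultimately show ?thesis by (simp add: plist_def)
qed

lemma pdec_member: "ptime f \<Longrightarrow> plist L \<Longrightarrow> pdec (\<lambda>d. f d \<in> set (L d))"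
proof -
  assume f: "ptime f" and L: "plist L"
  let ?h = "\<lambda>d a w. if a = f d then Br Lf Lf else w"
  have "fold (?h d) xs w = (if f d \<in> set xs then Br Lf Lf else w)" for d xs w
    by (induction xs arbitrary: w) auto
  then have "(\<lambda>d. if f d \<in> set (L d) then Br Lf Lf else Lf) = (\<lambda>d. fold (?h d) (L d) Lf)" by simp
  moreover have "ptime (\<lambda>d. fold (?h d) (L d) Lf)"
    by (rule ptime_fold_additive[where S = "\<lambda>_. 3"])
      (auto intro!: L ptime_comp[OF f] ptime_intros psize_intros)
  ultimately show ?thesis by (simp add: pdec_def)
qed

text \<open>The basic comprehension, from which mapping and filtering follow. An element is no
  larger than its list, so every appended block obeys one polynomial bound in
  \<open>d\<close>.\<close>

lemma plist_concat_map:
  assumes L: "plist L" and h: "plist (\<lambda>z. h (hd_bt z) (tl_bt z))"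
  shows "plist (\<lambda>d. concat (map (h d) (L d)))"
proof -
  let ?h = "\<lambda>d a w. tree_of (items w @ h d a)"
  obtain q where q: "\<And>z. nodes (tree_of (h (hd_bt z) (tl_bt z))) \<le> poly q (nodes z)"
    using plist_psize[OF h] unfolding psize_def by blast
  have bound: "nodes (tree_of (h d a)) \<le> poly q (1 + nodes d + nodes (tree_of (L d)))"
    if "a \<in> set (L d)" for d a
    using q[of "Br d a"] poly_nat_mono[of "1 + nodes d + nodes a" "1 + nodes d + nodes (tree_of (L d))" q]
      nodes_item[OF that] by simp
  have app: "nodes (tree_of (xs @ ys)) \<le> nodes (tree_of xs) + nodes (tree_of ys)" for xs ys
    by (simp add: nodes_tree_of)
  have "fold (?h d) xs (tree_of ys) = tree_of (ys @ concat (map (h d) xs))" for d xs ys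
    by (induction xs arbitrary: ys) auto
  from this[of _ _ "[]"]
  have "(\<lambda>d. tree_of (concat (map (h d) (L d)))) = (\<lambda>d. fold (?h d) (L d) Lf)" by simp
  moreover have "ptime (\<lambda>d. fold (?h d) (L d) Lf)"
  proof (rule ptime_fold_additive[where S = "\<lambda>d. poly q (1 + nodes d + nodes (tree_of (L d)))"])
    show "nodes (?h d a w) \<le> nodes w + poly q (1 + nodes d + nodes (tree_of (L d)))"
      if "a \<in> set (L d)" for d a w
      using app[of "items w" "h d a"] bound[OF that] by simp
  qed (intro L ptime_intros psize_intros plist_psize plist_append plist_comp2[OF h])+
  ultimately show ?thesis by (simp add: plist_def)
qed

lemma plist_map:
  assumes "plist L" "ptime (\<lambda>z. h (hd_bt z) (tl_bt z))"
  shows "plist (\<lambda>d. map (h d) (L d))"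
proof -
  have "plist (\<lambda>d. concat (map (\<lambda>a. [h d a]) (L d)))"
    by (intro plist_concat_map assms ptime_intros)
  then show ?thesis by simp
qed

lemma plist_filter:
  assumes "plist L" "pdec (\<lambda>z. P (hd_bt z) (tl_bt z))"
  shows "plist (\<lambda>d. filter (P d) (L d))"
proof -
  have "plist (\<lambda>d. concat (map (\<lambda>a. if P d a then [a] else []) (L d)))"
    by (intro plist_concat_map assms ptime_intros)
  moreover have "concat (map (\<lambda>a. if P d a then [a] else []) xs) = filter (P d) xs" for d xs
    by (induction xs) auto
  ultimately show ?thesis by simp
qed

text \<open>This is zipping, with pairs as trees. The accumulator holds the unread part of the
  second list and the output so far; it stays unchanged once the second list is used up.\<close>

lemma plist_map2_Br: "plist L \<Longrightarrow> plist K \<Longrightarrow> plist (\<lambda>d. map2 Br (L d) (K d))"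
proof -
  assume L: "plist L" and K: "plist K"
  let ?h = "\<lambda>a w. if hd_bt w = Lf then w
    else Br (tl_bt (hd_bt w)) (tree_of (items (tl_bt w) @ [Br a (hd_bt (hd_bt w))]))"
  have "tl_bt (fold ?h xs (Br (tree_of ys) (tree_of zs))) = tree_of (zs @ map2 Br xs ys)" for xs ys zs
  proof (induction xs arbitrary: ys zs)
    case (Cons x xs)
    have "fold ?h xs (Br Lf w) = Br Lf w" for w by (induction xs) auto
    with Cons.IH[of _ "zs @ [Br x _]"] show ?case by (cases ys) auto
  qed simp
  from this[of _ _ "[]"] have "(\<lambda>d. tree_of (map2 Br (L d) (K d))) =
      (\<lambda>d. tl_bt (fold ?h (L d) (Br (tree_of (K d)) Lf)))" by simp
  moreover
  have "nodes (?h a w) \<le> nodes w + (nodes a + 2)" for a w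
  \<comment> \<open>The element taken from the second list only moves within the accumulator, so the
    growth is due to \<open>a\<close> and to new inner nodes.\<close>
  proof (cases "hd_bt w")
    case (Br b r)
    then obtain v where "w = Br (Br b r) v" by (cases w) auto
    then show ?thesis using nodes_tree_of[of "items v"] by (simp add: nodes_tree_of)
  qed simp
  then have bound: "nodes (?h a w) \<le> nodes w + (nodes (tree_of (L d)) + 2)" if "a \<in> set (L d)" for d a w
    using nodes_item[OF that] by (meson add_left_mono add_right_mono le_trans)
  have "ptime (\<lambda>d. fold ?h (L d) (Br (tree_of (K d)) Lf))"
    by (rule ptime_fold_additive[where S = "\<lambda>d. nodes (tree_of (L d)) + 2", OF _ _ _ _ bound])
      (intro L K ptime_intros psize_intros plist_psize plist_append | assumption)+
  ultimately show ?thesis by (simp add: plist_def ptime_tl)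
qed

lemma plist_drop: "plist L \<Longrightarrow> plist K \<Longrightarrow> plist (\<lambda>d. drop (length (L d)) (K d))"
proof -
  assume L: "plist L" and K: "plist K"
  have "fold (\<lambda>_. tl_bt) xs (tree_of ys) = tree_of (drop (length xs) ys)" for xs :: "bt list" and ys
    by (induction xs arbitrary: ys) (auto simp: drop_Suc simp flip: tree_of_tl)
  then have "(\<lambda>d. tree_of (drop (length (L d)) (K d))) = (\<lambda>d. fold (\<lambda>_. tl_bt) (L d) (tree_of (K d)))" by simp
  moreover have "ptime (\<lambda>d. fold (\<lambda>_. tl_bt) (L d) (tree_of (K d)))"
    by (rule ptime_fold_additive[where S = "\<lambda>d. 0"])
      (auto intro!: L K ptime_intros psize_intros simp: nodes_tl)
  ultimately show ?thesis by (simp add: plist_def)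
qed

text \<open>Zipping stops at the end of the shorter list, so the second components of the zipped
  list are the desired prefix.\<close>

lemma plist_take: "plist L \<Longrightarrow> plist K \<Longrightarrow> plist (\<lambda>d. take (length (L d)) (K d))"
proof -
  assume L: "plist L" and K: "plist K"
  have "map tl_bt (map2 Br xs ys) = take (length xs) ys" for xs ys
    by (induction xs ys rule: list_induct2') auto
  moreover have "plist (\<lambda>d. map tl_bt (map2 Br (L d) (K d)))"
    by (intro plist_map plist_map2_Br L K ptime_intros)
  ultimately show ?thesis by simp
qed

text \<open>A fold that ignores the list elements iterates \<open>h d\<close>, with the length of
  \<open>L d\<close> as a unary counter; since \<open>h d\<close> never enlarges its argument, no
  size bound beyond the initial one arises.\<close>

lemma plist_iterate:
  assumes L: "plist L" and K: "plist K" and h: "plist (\<lambda>z. h (hd_bt z) (items (tl_bt z)))"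
    and shrink: "\<And>d xs. nodes (tree_of (h d xs)) \<le> nodes (tree_of xs)"
  shows "plist (\<lambda>d. (h d ^^ length (L d)) (K d))"
proof -
  let ?h = "\<lambda>d (_::bt) w. tree_of (h d (items w))"
  have "fold (?h d) xs (tree_of ys) = tree_of ((h d ^^ length xs) ys)" for d xs ys
    by (induction xs arbitrary: ys) (auto simp: funpow_swap1)
  then have "(\<lambda>d. tree_of ((h d ^^ length (L d)) (K d))) = (\<lambda>d. fold (?h d) (L d) (tree_of (K d)))" by simp
  moreover have "ptime (\<lambda>d. fold (?h d) (L d) (tree_of (K d)))"
  proof (rule ptime_fold_additive[where S = "\<lambda>d. 0"])
    show "nodes (?h d a w) \<le> nodes w + 0" for d a w using shrink[of d "items w"] by simp
  qed (intro L K ptime_intros psize_intros plist_comp2[where h = "\<lambda>d w. h d (items w)", OF h])+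
  ultimately show ?thesis by (simp add: plist_def)
qed

section \<open>The search algorithm\<close>

lemma byes_eq: "n \<le> 2 ^ k \<Longrightarrow> 2 ^ k < 2 * n \<Longrightarrow> byes n = 2 ^ k - n"
  unfolding byes_def
proof (rule Least_equality)
  assume n: "n \<le> 2 ^ k" "2 ^ k < 2 * n"
  then show "\<exists>j. n + (2 ^ k - n) = 2 ^ j" by (intro exI[of _ k]) simp
  fix b assume "\<exists>j. n + b = 2 ^ j"
  then obtain j where j: "n + b = 2 ^ j" by blast
  with n(2) have "(2::nat) ^ k < 2 ^ Suc j" by simp
  then have "k < Suc j" by (rule power_less_imp_less_exp[rotated]) simp
  then have "k \<le> j" by simp
  then have "(2::nat) ^ k \<le> 2 ^ j" by (rule power_increasing) simp
  with j show "2 ^ k - n \<le> b" by linarith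
qed

lemma power_2_sandwich: "(n :: nat) \<ge> 1 \<Longrightarrow> \<exists>k. n \<le> 2 ^ k \<and> 2 ^ k < 2 * n"
proof (induction n rule: nat_induct_at_least)
  case base
  show ?case by (intro exI[of _ 0]) simp
next
  case (Suc n)
  then obtain k where k: "n \<le> 2 ^ k" "2 ^ k < 2 * n" by blast
  show ?case
  proof (cases "Suc n \<le> 2 ^ k")
    case True
    with k show ?thesis by (intro exI[of _ k]) simp
  next
    case False
    with k Suc.hyps show ?thesis by (intro exI[of _ "Suc k"]) simp
  qed
qed

lemma byes_less: "n \<ge> 1 \<Longrightarrow> byes n < n"
  using power_2_sandwich[of n] byes_eq by fastforce

lemma byes_0: "byes 0 = 1"
  unfolding byes_def by (rule Least_equality) (auto intro: exI[of _ 0] simp: Suc_le_eq)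

text \<open>One more team uses up one bye. If \<open>n\<close> is a power of two, there is none to
  use up, and the next power \<open>2 * n\<close> leaves \<open>n - 1\<close>. This recursion
  replaces the search for a power of two.\<close>

lemma byes_Suc: "byes (Suc n) = (if byes n = 0 then n - 1 else byes n - 1)"
proof (cases n)
  case 0
  then show ?thesis using byes_less[of 1] by (simp add: byes_0)
next
  case (Suc m)
  with power_2_sandwich[of n] obtain k where k: "n \<le> 2 ^ k" "2 ^ k < 2 * n" by auto
  show ?thesis
  proof (cases "Suc n \<le> 2 ^ k")
    case True
    with k show ?thesis by (simp add: byes_eq[of n k] byes_eq[of "Suc n" k])
  next
    case False
    with k(1) have n: "n = 2 ^ k" by simp
    then have "byes n = 0" using byes_eq[of n k] by simp
    moreover have "byes (Suc n) = n - 1" using byes_eq[of "Suc n" "Suc k"] n Suc by simp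
    ultimately show ?thesis by simp
  qed
qed

text \<open>The accumulator pairs the byes of the elements read so far with their number, both in
  unary; it starts with \<open>byes 0 = 1\<close> and the number 0.\<close>

lemma plist_byes: "plist L \<Longrightarrow> plist (\<lambda>d. replicate (byes (length (L d))) Lf)"
proof -
  assume L: "plist L"
  define u where "u n = tree_of (replicate n Lf)" for n
  have u: "u 0 = Lf" "u (Suc n) = Br Lf (u n)" "u n = Lf \<longleftrightarrow> n = 0" "tl_bt (u n) = u (n - 1)"
    "nodes (u n) = 1 + 2 * n" for n
    by (cases n; simp add: u_def nodes_tree_of sum_list_replicate)+
  let ?h = "\<lambda>(_::bt) w. Br (if hd_bt w = Lf then tl_bt (tl_bt w) else tl_bt (hd_bt w)) (Br Lf (tl_bt w))"
  have inv: "fold ?h xs (Br (Br Lf Lf) Lf) = Br (u (byes (length xs))) (u (length xs))" for xs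
  proof (induction xs rule: rev_induct)
    case Nil
    show ?case using u(1) u(2)[of 0] by (simp add: byes_0)
  next
    case (snoc x xs)
    then show ?case by (simp add: u byes_Suc)
  qed
  have "ptime (\<lambda>d. fold ?h (L d) (Br (Br Lf Lf) Lf))"
  proof (rule ptime_fold[where S = "\<lambda>d. 5 + 4 * nodes (tree_of (L d))"])
    fix d xs ys
    assume "L d = xs @ ys"
    then have "length xs \<le> nodes (tree_of (L d))" by (simp add: nodes_tree_of)
    \<comment> \<open>The extra 1 is for the empty list, the only one with more byes than
      teams.\<close>
    moreover have "byes (length xs) \<le> length xs + 1"
      using byes_less[of "length xs"] byes_0 by (cases xs) auto
    ultimately show "nodes (fold ?h xs (Br (Br Lf Lf) Lf)) \<le> 5 + 4 * nodes (tree_of (L d))"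
      by (simp add: inv u)
  qed (intro L ptime_intros psize_intros plist_psize)+
  then have "ptime (\<lambda>d. hd_bt (fold ?h (L d) (Br (Br Lf Lf) Lf)))" by (rule ptime_hd)
  then show ?thesis by (simp add: plist_def inv u_def)
qed

section \<open>The cup and the search on trees\<close>

lemma next_round_unary:
  "next_round R ts = take (length (replicate (byes (length ts)) Lf)) ts @
     map hd_bt (filter (\<lambda>p. (hd_bt p, tl_bt p) \<in> R)
       (map2 Br (drop (length (replicate (byes (length ts)) Lf)) ts)
         (rev (drop (length (replicate (byes (length ts)) Lf)) ts))))"
proof -
  have "map fst (filter (\<lambda>g. g \<in> R) (zip xs ys)) = map hd_bt (filter (\<lambda>p. (hd_bt p, tl_bt p) \<in> R) (map2 Br xs ys))"
    for xs ys by (induction xs ys rule: list_induct2') auto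
  then show ?thesis by (simp add: next_round_def game_winners_def Let_def)
qed

lemma pdec_rel:
  assumes "pdec (\<lambda>z. (hd_bt (tl_bt z), tl_bt (tl_bt z)) \<in> R (hd_bt z))" "ptime f" "ptime x" "ptime y"
  shows "pdec (\<lambda>d. (x d, y d) \<in> R (f d))"
  using pdec_comp[OF assms(1) ptime_Br[OF assms(2) ptime_Br[OF assms(3,4)]]] by simp

lemma plist_next_round:
  assumes "pdec (\<lambda>z. (hd_bt (tl_bt z), tl_bt (tl_bt z)) \<in> R (hd_bt z))" "plist L"
  shows "plist (\<lambda>d. next_round (R d) (L d))"
  unfolding next_round_unary
  by (intro plist_append plist_take plist_map plist_filter plist_map2_Br plist_rev plist_drop plist_byes
      assms ptime_intros)

text \<open>
  A step is idle once at most one team is left, so the number of teams is a safe number of rounds.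
\<close>

definition cup_round :: "'a rel \<Rightarrow> 'a list \<Rightarrow> 'a list" where
  "cup_round R ts = (if tl ts = [] then ts else next_round R ts)"

definition cup :: "'a rel \<Rightarrow> 'a list \<Rightarrow> 'a list" where
  "cup R ts = (cup_round R ^^ length ts) ts"

text \<open>The survivors are a selection from the old list whatever \<open>R\<close> is. The
  arbitrary relation matters: the size bound must hold for every input tree, not only for encoded
  instances.\<close>

lemma nodes_next_round: "nodes (tree_of (next_round R ts)) \<le> nodes (tree_of ts)"
proof -
  have app: "nodes (tree_of (xs @ ys)) + 1 = nodes (tree_of xs) + nodes (tree_of ys)" for xs ys
    by (simp add: nodes_tree_of)
  have "nodes (tree_of (map fst (filter P (zip xs ys)))) \<le> nodes (tree_of xs)" for P and xs ys :: "bt list"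
    by (induction xs ys rule: list_induct2') auto
  then have "nodes (tree_of (game_winners R xs)) \<le> nodes (tree_of xs)" for xs
    unfolding game_winners_def .
  from this[of "drop _ ts"] have "nodes (tree_of (take b ts @ game_winners R (drop b ts))) \<le> nodes (tree_of ts)" for b
    using app[of "take b ts" "game_winners R (drop b ts)"] app[of "take b ts" "drop b ts"]
    by (simp del: One_nat_def) (metis add_le_cancel_left add_le_cancel_right)
  then show ?thesis by (simp add: next_round_def Let_def)
qed

lemma plist_cup:
  assumes R: "pdec (\<lambda>z. (hd_bt (tl_bt z), tl_bt (tl_bt z)) \<in> R (hd_bt z))" and L: "plist L"
  shows "plist (\<lambda>d. cup (R d) (L d))"
  unfolding cup_def
proof (rule plist_iterate[OF L L])
  show "plist (\<lambda>z. cup_round (R (hd_bt z)) (items (tl_bt z)))"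
    unfolding cup_round_def
    by (intro plist_next_round pdec_rel[OF R] ptime_intros)
  show "nodes (tree_of (cup_round (R d) xs)) \<le> nodes (tree_of xs)" for d xs
    by (simp add: cup_round_def nodes_next_round)
qed

text \<open>Each candidate is already the encoding of a list: \<open>Lf\<close> is the empty one and
  \<open>Br g M\<close> puts \<open>g\<close> in front of \<open>M\<close>.\<close>

fun candidates :: "nat \<Rightarrow> bt list \<Rightarrow> bt list" where
  "candidates 0 G = [Lf]"
| "candidates (Suc k) G = candidates k G @ concat (map (\<lambda>M. map (\<lambda>g. Br g M) G) (candidates k G))"

lemma plist_candidates:
  assumes G: "plist G"
  shows "plist (\<lambda>d. candidates k (G d))"
proof (induction k)
  case (Suc k)
  show ?case
    unfolding candidates.simps
    by (intro plist_append plist_concat_map plist_map plist_comp[OF G] G Suc.IH ptime_intros)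
qed (simp add: ptime_intros)

definition manipulate_tree :: "bt list \<Rightarrow> bt list \<Rightarrow> bt rel" where
  "manipulate_tree G M = {(x, y). Br x y \<in> set G \<and> Br x y \<notin> set M \<or> Br y x \<in> set M}"

lemma pdec_manipulate_tree:
  assumes "plist G" "plist M" "ptime x" "ptime y"
  shows "pdec (\<lambda>d. (x d, y d) \<in> manipulate_tree (G d) (M d))"
proof -
  have "pdec (\<lambda>d. Br (x d) (y d) \<in> set (G d) \<and> Br (x d) (y d) \<notin> set (M d) \<or> Br (y d) (x d) \<in> set (M d))"
    by (intro pdec_disj pdec_conj pdec_not pdec_member ptime_Br assms)
  then show ?thesis by (simp add: manipulate_tree_def)
qed

text \<open>The projections follow the layout of \<open>enc_instance\<close>: ranking, games,
  coalition, favourite. \<open>G'\<close> keeps the games that a coalition member would win, the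
  only ones it may throw.\<close>

definition tree_solutions :: "nat \<Rightarrow> bt \<Rightarrow> bt list" where
  "tree_solutions k d =
     (let G = items (hd_bt (tl_bt d));
          G' = filter (\<lambda>g. hd_bt g \<in> set (items (hd_bt (tl_bt (tl_bt d))))) G
      in filter (\<lambda>M. cup (manipulate_tree G (items M)) (items (hd_bt d)) = [tl_bt (tl_bt (tl_bt d))])
           (candidates k G'))"

definition tree_answer :: "nat \<Rightarrow> bt \<Rightarrow> bt" where
  "tree_answer k d = (if tree_solutions k d = [] then Lf else Br (hd_bt (tree_of (tree_solutions k d))) Lf)"

lemma ptime_tree_answer: "ptime (tree_answer k)"
proof -
  have "plist (\<lambda>d. tree_solutions k d)"
    unfolding tree_solutions_def Let_def
    by (intro plist_filter plist_candidates plist_cup pdec_manipulate_tree pdec_member ptime_intros)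
  then have "ptime (\<lambda>d. tree_answer k d)"
    unfolding tree_answer_def by (intro ptime_intros)
  then show ?thesis by simp
qed

section \<open>Simulating the cup and bounding the manipulations\<close>

text \<open>The pairing depends only on positions in the ranking and the outcome only on the
  relation, so renaming the teams commutes with playing a round.\<close>

lemma next_round_map:
  assumes "\<And>x y. (f x, f y) \<in> R' \<longleftrightarrow> (x, y) \<in> R"
  shows "next_round R' (map f ts) = map f (next_round R ts)"
proof -
  have "map fst (filter (\<lambda>g. g \<in> R') (zip (map f xs) (map f ys))) = map f (map fst (filter (\<lambda>g. g \<in> R) (zip xs ys)))"
    for xs ys by (induction xs ys rule: list_induct2') (auto simp: assms)
  then show ?thesis
    by (simp add: next_round_def game_winners_def Let_def take_map drop_map rev_map)
qed

lemma cup_map: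
  assumes "\<And>x y. (f x, f y) \<in> R' \<longleftrightarrow> (x, y) \<in> R"
  shows "cup R' (map f ts) = map f (cup R ts)"
proof -
  have "cup_round R' (map f ts) = map f (cup_round R ts)" for ts
    by (simp add: cup_round_def next_round_map[OF assms] flip: map_tl)
  then have "(cup_round R' ^^ n) (map f ts) = map f ((cup_round R ^^ n) ts)" for n
    by (induction n) simp_all
  then show ?thesis by (simp add: cup_def)
qed

lemma zip_rev_swap: "(x, y) \<in> set (zip zs (rev zs)) \<Longrightarrow> (y, x) \<in> set (zip zs (rev zs))"
proof -
  assume "(x, y) \<in> set (zip zs (rev zs))"
  then obtain i where i: "i < length zs" "x = zs ! i" "y = rev zs ! i"
    by (auto simp: set_zip)
  then show ?thesis
    by (auto simp: set_zip rev_nth intro!: exI[of _ "length zs - Suc i"])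
qed

lemma set_game_winners: "set (game_winners R zs) \<subseteq> set zs"
  by (auto simp: game_winners_def dest: set_zip_leftD)

lemma set_next_round: "set (next_round R ts) \<subseteq> set ts"
  using set_game_winners by (fastforce simp: next_round_def Let_def dest: in_set_takeD in_set_dropD)

lemma length_next_round:
  assumes "asym R" "ts \<noteq> []"
  shows "length (next_round R ts) < length ts"
proof -
  define b where "b = byes (length ts)"
  have b: "b < length ts" using assms(2) byes_less[of "length ts"] by (cases ts) (auto simp: b_def)
  then obtain x xs where zs: "drop b ts = x # xs" by (cases "drop b ts") auto
  have "\<exists>y. (x, y) \<in> set (zip (x # xs) (rev (x # xs)))"
    by (metis in_set_impl_in_set_zip1 length_rev list.set_intros(1))
  then obtain y where "(x, y) \<in> set (zip (drop b ts) (rev (drop b ts)))" using zs by auto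
  \<comment> \<open>A game is listed in both directions and at most one of them lies in
    \<open>R\<close>; if \<open>x = y\<close>, as for a single team, asymmetry excludes the entry
    itself.\<close>
  with zip_rev_swap[OF this] assms(1) obtain g where "g \<in> set (zip (drop b ts) (rev (drop b ts)))" "g \<notin> R"
    by (metis asymD)
  then have "length (game_winners R (drop b ts)) < length (zip (drop b ts) (rev (drop b ts)))"
    unfolding game_winners_def length_map by (rule length_filter_less)
  with b show ?thesis by (simp add: next_round_def Let_def b_def)
qed

text \<open>Asymmetry makes every round eliminate a team, so as many rounds as there are teams
  suffice, and a single remaining team is a fixed point.\<close>

lemma wins_cup_iff_cup:
  assumes "asym R"
  shows "wins_cup R ts v \<longleftrightarrow> cup R ts = [v]"
proof
  show "wins_cup R ts v" if "cup R ts = [v]"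
  proof -
    have "(cup_round R ^^ n) ts = [v] \<Longrightarrow> wins_cup R ts v" for n
    proof (induction n arbitrary: ts)
      case (Suc n)
      then have w: "wins_cup R (cup_round R ts) v" by (simp add: funpow_swap1)
      show ?case
      proof (cases "tl ts = []")
        case False
        then have "length ts > 1" by (cases ts) auto
        with w False show ?thesis by (auto simp: cup_round_def intro: round)
      qed (use w in \<open>simp add: cup_round_def\<close>)
    qed (simp add: last_team)
    with that show ?thesis by (simp add: cup_def)
  qed
  assume "wins_cup R ts v"
  \<comment> \<open>Allowing any sufficient number of rounds lets the induction hypothesis apply to
    the shorter list, where more rounds are left than it has teams.\<close>
  then have "(cup_round R ^^ n) ts = [v]" if "length ts \<le> n" for n
    using that
  proof (induction arbitrary: n)
    case (last_team v)
    show ?case by (induction n) (simp_all add: cup_round_def)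
  next
    case (round ts v)
    then obtain m where m: "n = Suc m" by (cases n) auto
    from round.hyps have ts: "ts \<noteq> []" "tl ts \<noteq> []" by (cases ts; auto)+
    then have "cup_round R ts = next_round R ts" by (simp add: cup_round_def)
    moreover have "(cup_round R ^^ m) (next_round R ts) = [v]"
      using length_next_round[OF assms ts(1)] round.prems m by (intro round.IH) simp
    ultimately show ?case by (simp add: m funpow_swap1)
  qed
  then show "cup R ts = [v]" by (simp add: cup_def)
qed

section \<open>At most one manipulation per team\<close>

lemma next_round_cong:
  assumes "\<And>x y. (x, y) \<in> set (zip (drop (byes (length ts)) ts) (rev (drop (byes (length ts)) ts))) \<Longrightarrow>
    (x, y) \<in> R \<longleftrightarrow> (x, y) \<in> R'"
  shows "next_round R ts = next_round R' ts"
  using assms unfolding next_round_def game_winners_def Let_def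
  by (intro arg_cong2[of _ _ _ _ "(@)"] arg_cong[of _ _ "map fst"] filter_cong) auto

lemma wins_cup_cong:
  assumes "wins_cup R ts v" "\<And>x y. x \<in> set ts \<Longrightarrow> y \<in> set ts \<Longrightarrow> (x, y) \<in> R \<longleftrightarrow> (x, y) \<in> R'"
  shows "wins_cup R' ts v"
  using assms
proof (induction rule: wins_cup.induct)
  case (round ts v)
  have "next_round R ts = next_round R' ts"
    by (rule next_round_cong, rule round.prems)
      (metis in_set_dropD set_zip_leftD, metis in_set_dropD set_rev set_zip_rightD)
  moreover have "wins_cup R' (next_round R ts) v"
    using round.prems set_next_round[of R ts] by (intro round.IH) blast
  ultimately show ?case using round.hyps(1) by (simp add: wins_cup.round)
qed (rule last_team)

lemma distinct_next_round:
  assumes "distinct ts"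
  shows "distinct (next_round R ts)"
proof -
  have "distinct (game_winners R zs)" if "distinct zs" for zs
    using that unfolding game_winners_def by (intro distinct_map_filter) simp
  moreover have "set (take b ts) \<inter> set (game_winners R (drop b ts)) = {}" for b
    using set_game_winners[of R "drop b ts"] set_take_disj_set_drop_if_distinct[OF assms, of b b] by blast
  ultimately show ?thesis using assms by (simp add: next_round_def Let_def)
qed

text \<open>A team that throws a game is eliminated, so it throws at most one of the games played.\<close>

lemma sparse_manipulation:
  assumes "wins_cup (manipulate E M) ts v" "M \<subseteq> E" "asym E" "distinct ts"
  shows "\<exists>M' \<subseteq> M. inj_on fst M' \<and> fst ` M' \<subseteq> set ts \<and> wins_cup (manipulate E M') ts v"
  using assms(1,4)
proof (induction rule: wins_cup.induct)
  case (last_team v)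
  show ?case by (intro exI[of _ "{}"]) (auto intro: wins_cup.last_team)
next
  case (round ts v)
  let ?N = "next_round (manipulate E M) ts"
  define zs where "zs = drop (byes (length ts)) ts"
  define Z where "Z = set (zip zs (rev zs))"
  from round.IH distinct_next_round[OF round.prems] obtain M1 where M1: "M1 \<subseteq> M" "inj_on fst M1"
    "fst ` M1 \<subseteq> set ?N" "wins_cup (manipulate E M1) ?N v" by blast
  \<comment> \<open>\<open>Z\<close> contains the games of this round, in both directions. To the
    manipulations \<open>M1\<close> needed in later rounds, exactly those that affect this round are
    added.\<close>
  let ?M = "M1 \<union> (M \<inter> Z)"
  have zs: "distinct zs" "set zs \<subseteq> set ts"
    using round.prems set_drop_subset[of _ ts] by (auto simp: zs_def)
  have fstZ: "fst ` Z \<subseteq> set zs" by (auto simp: Z_def dest: set_zip_leftD)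
  have injZ: "inj_on fst Z"
    using zs(1) unfolding Z_def by (metis distinct_map distinct_rev length_rev map_fst_zip)
  have N: "?N = take (byes (length ts)) ts @ map fst (filter (\<lambda>g. g \<in> manipulate E M) (zip zs (rev zs)))"
    by (simp add: next_round_def game_winners_def Let_def zs_def)
  \<comment> \<open>The opponent \<open>w\<close> of \<open>u\<close> in this round is unique, the
    edge from \<open>u\<close> to \<open>w\<close> is reversed, and asymmetry with
    \<open>M \<subseteq> E\<close> keeps it from being restored; a team in \<open>Z\<close> has no
    bye. So no thrower of this round is a thrower in \<open>M1\<close>, which gives injectivity of
    \<open>fst\<close> on the union.\<close>
  have lost: "u \<notin> set ?N" if u: "(u, w) \<in> M" "(u, w) \<in> Z" for u w
  proof -
    have "(u, w') \<notin> manipulate E M" if "(u, w') \<in> Z" for w'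
    proof -
      have "w' = w" using inj_onD[OF injZ, of "(u, w')" "(u, w)"] that u by simp
      then show ?thesis using u \<open>M \<subseteq> E\<close> \<open>asym E\<close> by (auto simp: manipulate_def dest: asymD)
    qed
    moreover have "u \<in> set zs" using u fstZ by force
    then have "u \<notin> set (take (byes (length ts)) ts)"
      using set_take_disj_set_drop_if_distinct[OF round.prems, of "byes (length ts)" "byes (length ts)"]
      by (auto simp: zs_def)
    ultimately show ?thesis by (auto simp: N Z_def)
  qed
  have "inj_on fst ?M"
    unfolding inj_on_Un using M1(2,3) lost injZ by (fastforce simp: inj_on_def)
  moreover have "fst ` ?M \<subseteq> set ts"
    using M1(3) set_next_round[of "manipulate E M" ts] fstZ zs(2) by blast
  moreover have "wins_cup (manipulate E ?M) ts v"
  proof (rule wins_cup.round)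
    \<comment> \<open>On \<open>Z\<close>, which is closed under reversal, \<open>?M\<close> and
      \<open>M\<close> agree because \<open>M1 \<subseteq> M\<close>.\<close>
    have "next_round (manipulate E ?M) ts = ?N"
      using M1(1) zip_rev_swap[of _ _ zs]
      by (intro next_round_cong) (auto simp: manipulate_def Z_def zs_def)
    \<comment> \<open>The manipulations added to \<open>M1\<close> affect only pairs containing an
      eliminated team, so they are invisible among the teams of \<open>?N\<close>.\<close>
    moreover have "wins_cup (manipulate E ?M) ?N v"
      by (rule wins_cup_cong[OF M1(4)]) (use lost in \<open>auto simp: manipulate_def\<close>)
    ultimately show "wins_cup (manipulate E ?M) (next_round (manipulate E ?M) ts) v" by simp
  qed (rule round.hyps(1))
  ultimately show ?case using M1(1) by (intro exI[of _ ?M]) auto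
qed

section \<open>Correctness of the search on encodings\<close>

lemma inj_enc_nat: "enc_nat m = enc_nat n \<longleftrightarrow> m = n"
proof
  show "enc_nat m = enc_nat n \<Longrightarrow> m = n"
  proof (induction m arbitrary: n rule: less_induct)
    case (less m)
    show ?case
    proof (cases "m = 0 \<or> n = 0")
      case True
      with less.prems show ?thesis by (auto simp: enc_nat.simps split: if_splits)
    next
      case False
      then have "odd m \<longleftrightarrow> odd n" "enc_nat (m div 2) = enc_nat (n div 2)"
        using less.prems by (auto simp: enc_nat.simps[of m] enc_nat.simps[of n] split: if_splits)
      moreover from this False have "m div 2 = n div 2" by (intro less.IH) auto
      ultimately show ?thesis by (metis odd_two_times_div_two_succ even_two_times_div_two)
    qed
  qed
qed simp

abbreviation enc_game :: "nat \<times> nat \<Rightarrow> bt" where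
  "enc_game \<equiv> enc_pair enc_nat enc_nat"

lemma enc_game_eq_Br: "enc_game g = Br (enc_nat x) (enc_nat y) \<longleftrightarrow> g = (x, y)"
  by (cases g) (simp add: inj_enc_nat)

lemma set_candidates:
  "set (candidates k (map f G)) = enc_list f ` {ms. set ms \<subseteq> set G \<and> length ms \<le> k}"
proof (induction k)
  case (Suc k)
  have "{ms. set ms \<subseteq> set G \<and> length ms \<le> Suc k} =
      {ms. set ms \<subseteq> set G \<and> length ms \<le> k} \<union> {g # ms | g ms. g \<in> set G \<and> set ms \<subseteq> set G \<and> length ms \<le> k}"
    (is "?A = ?B \<union> ?C")
  proof (intro set_eqI)
    show "ms \<in> ?A \<longleftrightarrow> ms \<in> ?B \<union> ?C" for ms by (cases ms) auto
  qed
  moreover have "enc_list f ` ?C = (\<Union>ms \<in> ?B. (\<lambda>g. Br (f g) (enc_list f ms)) ` set G)"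
    by (simp flip: enc_list.simps(2)) blast
  then have "set (candidates (Suc k) (map f G)) = enc_list f ` ?B \<union> enc_list f ` ?C"
    by (simp add: Suc.IH image_image)
  ultimately show ?case by (simp only: image_Un)
qed auto

lemma manipulate_tree_enc:
  "(enc_nat x, enc_nat y) \<in> manipulate_tree (map enc_game gs) (map enc_game ms) \<longleftrightarrow>
    (x, y) \<in> manipulate (set gs) (set ms)"
proof -
  have "Br (enc_nat x) (enc_nat y) \<in> set (map enc_game hs) \<longleftrightarrow> (x, y) \<in> set hs" for x y hs
    by (metis (no_types, lifting) enc_game_eq_Br enc_pair.simps image_iff list.set_map)
  then show ?thesis by (simp only: manipulate_tree_def manipulate_def) auto
qed

lemma asym_manipulate: "asym E \<Longrightarrow> M \<subseteq> E \<Longrightarrow> asym (manipulate E M)"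
  by (rule asymI) (auto simp: manipulate_def dest: asymD)

lemma asym_tournament: "tournament V E \<Longrightarrow> asym E"
  by (rule asymI) (metis SigmaD1 SigmaD2 irrefl_def subsetD tournament_def)

lemma mem_tree_solutions:
  assumes "asym (set (games X))"
  shows "t \<in> set (tree_solutions k (enc_instance X)) \<longleftrightarrow>
    (\<exists>ms. t = enc_list enc_game ms \<and> length ms \<le> k \<and> successful X (set ms))"
proof -
  let ?G = "filter (\<lambda>g. fst g \<in> set (coalition X)) (games X)"
  have G: "filter (\<lambda>g. hd_bt g \<in> set (map enc_nat (coalition X))) (map enc_game gs) =
      map enc_game (filter (\<lambda>g. fst g \<in> set (coalition X)) gs)" for gs
    by (induction gs) (auto simp: inj_enc_nat)
  let ?wins = "\<lambda>M. cup (manipulate_tree (map enc_game (games X)) (items M)) (map enc_nat (ranking X)) =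
      [enc_nat (favourite X)]"
  have wins: "?wins (enc_list enc_game ms) \<longleftrightarrow>
      wins_cup (manipulate (set (games X)) (set ms)) (ranking X) (favourite X)"
    if "set ms \<subseteq> set (games X)" for ms
    unfolding enc_list_eq_tree_of[of enc_game] items_tree_of cup_map[OF manipulate_tree_enc]
      wins_cup_iff_cup[OF asym_manipulate[OF assms that]]
    by (auto simp: map_eq_Cons_conv inj_enc_nat)
  \<comment> \<open>The simulation is faithful only for manipulations that are games, as otherwise
    the manipulated relation need not be asymmetric; the choice of candidates ensures this.\<close>
  have succ: "set ms \<subseteq> set ?G \<and> ?wins (enc_list enc_game ms) \<longleftrightarrow> successful X (set ms)" for ms
  proof -
    have "set ms \<subseteq> set ?G \<longleftrightarrow> manipulations_by (set (coalition X)) (set (games X)) (set ms)"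
      by (auto simp: manipulations_by_def)
    moreover have "set ms \<subseteq> set ?G \<Longrightarrow> set ms \<subseteq> set (games X)" by auto
    ultimately show ?thesis unfolding successful_def using wins by metis
  qed
  have "tree_solutions k (enc_instance X) = filter ?wins (candidates k (map enc_game ?G))"
    unfolding tree_solutions_def Let_def enc_instance_def hd_bt.simps tl_bt.simps
      enc_list_eq_tree_of[of enc_nat] enc_list_eq_tree_of[of enc_game] items_tree_of G ..
  then have "t \<in> set (tree_solutions k (enc_instance X)) \<longleftrightarrow>
      (\<exists>ms. t = enc_list enc_game ms \<and> length ms \<le> k \<and> set ms \<subseteq> set ?G \<and> ?wins (enc_list enc_game ms))"
    by (auto simp only: set_filter[of ?wins] set_candidates)
  then show ?thesis unfolding succ .
qed

text \<open>The throwing teams of a sparse manipulation are pairwise distinct coalition members, so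
  there are at most as many manipulations as members; \<open>ms\<close> lists them without
  repetition.\<close>

lemma short_solution:
  assumes X: "cup_instance X" and M: "successful X M"
  obtains ms where "successful X (set ms)" "length ms \<le> card (set (coalition X))"
proof -
  from X have asym: "asym (set (games X))" by (auto simp: cup_instance_def intro: asym_tournament)
  from X M asym obtain M' where M': "M' \<subseteq> M" "inj_on fst M'"
    "wins_cup (manipulate (set (games X)) M') (ranking X) (favourite X)"
    using sparse_manipulation[of "set (games X)" M "ranking X" "favourite X"]
    by (auto simp: successful_def manipulations_by_def cup_instance_def)
  have sub: "M' \<subseteq> set (games X)" and C: "\<And>u v. (u, v) \<in> M' \<Longrightarrow> u \<in> set (coalition X)"
    using M M'(1) by (auto simp: successful_def manipulations_by_def)
  with M'(3) have M'': "successful X M'" "fst ` M' \<subseteq> set (coalition X)"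
    by (auto simp: successful_def manipulations_by_def)
  from sub have "finite M'" by (meson finite_subset finite_set)
  then obtain ms where ms: "set ms = M'" "distinct ms" by (metis finite_distinct_list)
  have "length ms = card (fst ` M')" using ms M'(2) by (metis card_image distinct_card)
  also have "\<dots> \<le> card (set (coalition X))" using M''(2) by (simp add: card_mono)
  finally show ?thesis using M''(1) ms(1) by (intro that) simp_all
qed

theorem theorem7:
  fixes c :: nat
  shows "poly_time_search
           enc_instance (enc_option (enc_list (enc_pair enc_nat enc_nat)))
           {X. cup_instance X \<and> card (set (coalition X)) \<le> c}
           correct_answer"
proof -
  from ptime_tree_answer obtain p N q where p: "computes p N (\<lambda>d. poly q (nodes d)) (tree_answer c)"
    by (rule ptimeE)
  have "\<exists>t s y. exec p (initial_store (enc_instance X)) t s \<and> t \<le> poly q (nodes (enc_instance X)) \<and>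
      s 0 = enc_option (enc_list enc_game) y \<and> correct_answer X y"
    if X: "cup_instance X" "card (set (coalition X)) \<le> c" for X
  proof -
    have sols: "t \<in> set (tree_solutions c (enc_instance X)) \<longleftrightarrow>
        (\<exists>ms. t = enc_list enc_game ms \<and> length ms \<le> c \<and> successful X (set ms))" for t
      using X(1) by (intro mem_tree_solutions) (auto simp: cup_instance_def intro: asym_tournament)
    have "\<exists>y. tree_answer c (enc_instance X) = enc_option (enc_list enc_game) y \<and> correct_answer X y"
    proof (cases "tree_solutions c (enc_instance X)")
      case Nil
      \<comment> \<open>Any successful set, of whatever size, would yield one listed with length at
        most \<open>c\<close>, which the exhaustive search would have found.\<close>
      have "\<nexists>M. successful X M"
        by (metis Nil X le_trans list.set(1) empty_iff short_solution sols)
      with Nil show ?thesis by (intro exI[of _ None]) (simp add: tree_answer_def correct_answer_def)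
    next
      case (Cons t ts)
      then obtain ms where "t = enc_list enc_game ms" "successful X (set ms)" using sols[of t] by auto
      with Cons show ?thesis by (intro exI[of _ "Some ms"]) (simp add: tree_answer_def correct_answer_def)
    qed
    moreover obtain t s where "exec p (initial_store (enc_instance X)) t s" "t \<le> poly q (nodes (enc_instance X))"
      "s 0 = tree_answer c (enc_instance X)"
      using p unfolding computes_def wp_def
      by (metis fun_upd_same initial_store_def)
    ultimately show ?thesis by metis
  qed
  then show ?thesis unfolding poly_time_search_def by blast
qed

end
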